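(* Let $\mathcal{K}=\mathcal{K}_1\times\mathcal{K}_2$ and $\bar x=(\bar x_1,\bar x_2)$ with $\bar x_2=0$. Let $(\alpha_1,\beta,u,\lambda_{1,\cdot},v)$ be feasible for the reduced cut-generating conic problem $$\min\ \alpha_1^T\bar x_1-\beta\quad\text{s.t.}\quad \alpha_1=A_1^Tu_h+\lambda_{1,h}+D_{1,h}^Tv_h\ \ \forall h,\quad \beta\le b^Tu_h+d_h^Tv_h\ \ \forall h,\quad (u_h,\lambda_{1,h},v_h)\in\mathbb{R}^m\times\mathcal{K}_1^*\times\mathcal{Q}_h^*\ \ \forall h.$$ Let $\alpha_2\in\mathbb{R}^{n_2}$ satisfy $$\alpha_2-\left(A_2^Tu_h+D_{2,h}^Tv_h\right)\in\mathcal{K}_2^*\quad\forall h,$$ and, for all $h$, let $\lambda_{2,h}=\alpha_2-A_2^Tu_h-D_{2,h}^Tv_h$. Set $\alpha=(\alpha_1,\alpha_2)$ and $\lambda_h=(\lambda_{1,h},\lambda_{2,h})$. Then $(\alpha,\beta,u,\lambda,v)$ is feasible for the cut-generating conic problem $$\min\ \alpha^T\bar x-\beta\quad\text{s.t.}\quad \alpha=A^Tu_h+\lambda_h+D_h^Tv_h\ \ \forall h,\quad \beta\le b^Tu_h+d_h^Tv_h\ \ \forall h,\quad (u_h,\lambda_h,v_h)\in\mathbb{R}^m\times\mathcal{K}^*\times\mathcal{Q}_h^*\ \ \forall h,$$ and $\alpha^T\bar x-\beta=\alpha_1^T\bar x_1-\beta$.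
   Context: Setting: $h$ ranges over $\{1,\dots,H\}$; $A=[A_1\ A_2]\in\mathbb{R}^{m\times n}$ with $A_i\in\mathbb{R}^{m\times n_i}$, $n=n_1+n_2$; $b\in\mathbb{R}^m$; $\mathcal{K}_i\subseteq\mathbb{R}^{n_i}$ ($i=1,2$) are proper cones (closed, convex, pointed, with non-empty interior) and $\mathcal{K}=\mathcal{K}_1\times\mathcal{K}_2$; for each $h$, $D_h=[D_{1,h}\ D_{2,h}]\in\mathbb{R}^{m_h\times n}$ is partitioned accordingly, $d_h\in\mathbb{R}^{m_h}$, and $\mathcal{Q}_h\subseteq\mathbb{R}^{m_h}$ is a proper cone. The point $\bar x\in\mathbb{R}^n$ satisfies $A\bar x=b$. For a cone $\mathcal{C}$, the dual cone is $\mathcal{C}^*=\{u : u^Tx\ge 0\ \forall x\in\mathcal{C}\}$. *)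

theory Defs
  imports "HOL-Analysis.Abstract_Euclidean_Space" "Jordan_Normal_Form.Matrix"
begin

unbundle no inner_syntax and no vec_syntax

text \<open>The block matrix \<open>[A B]\<close>, the column analogue of \<^const>\<open>append_rows\<close>.\<close>

definition append_cols :: "'a::zero mat \<Rightarrow> 'a mat \<Rightarrow> 'a mat" (infixr \<open>@\<^sub>c\<close> 65) where
  "A @\<^sub>c B = four_block_mat A B (0\<^sub>m 0 (dim_col A)) (0\<^sub>m 0 (dim_col B))"

lemma append_cols_carrier [simp, intro]:
  assumes "A \<in> carrier_mat m n1" and "B \<in> carrier_mat m n2"
  shows "A @\<^sub>c B \<in> carrier_mat m (n1 + n2)"
  using assms by (auto simp: append_cols_def)

text \<open>The usual topology of \<open>\<real>\<^sup>n\<close> on \<^term>\<open>carrier_vec n\<close>, transported from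
  \<^term>\<open>Euclidean_space n\<close>, whose points are the sequences vanishing from index \<open>n\<close> on.\<close>

definition vec_topology :: "nat \<Rightarrow> real vec topology" where
  "vec_topology n =
     pullback_topology (carrier_vec n) (\<lambda>x i. if i < n then x $ i else 0) (Euclidean_space n)"

lemma topspace_vec_topology [simp]: "topspace (vec_topology n) = carrier_vec n"
  by (auto simp: vec_topology_def topspace_pullback_topology topspace_Euclidean_space)

definition proper_cone :: "nat \<Rightarrow> real vec set \<Rightarrow> bool" where
  "proper_cone n C \<longleftrightarrow>
     C \<subseteq> carrier_vec n \<and>
     (\<forall>x\<in>C. \<forall>c\<ge>0. c \<cdot>\<^sub>v x \<in> C) \<and>
     closedin (vec_topology n) C \<and>
     (\<forall>x\<in>C. \<forall>y\<in>C. \<forall>s\<ge>0. \<forall>t\<ge>0. s + t = 1 \<longrightarrow> s \<cdot>\<^sub>v x + t \<cdot>\<^sub>v y \<in> C) \<and>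
     (\<forall>x\<in>C. - x \<in> C \<longrightarrow> x = 0\<^sub>v n) \<and>
     vec_topology n interior_of C \<noteq> {}"

definition dual_cone :: "nat \<Rightarrow> real vec set \<Rightarrow> real vec set" where
  "dual_cone n C = {u \<in> carrier_vec n. \<forall>x\<in>C. u \<bullet> x \<ge> 0}"

text \<open>\<open>C \<times> D\<close>, with a pair of vectors identified with its concatenation.\<close>

definition cone_prod :: "real vec set \<Rightarrow> real vec set \<Rightarrow> real vec set" where
  "cone_prod C D = {x @\<^sub>v y | x y. x \<in> C \<and> y \<in> D}"

text \<open>Feasibility and objective of the cut-generating conic problem with data \<open>A\<close> (of size
  \<open>m \<times> n\<close>), \<open>b\<close>, \<open>K\<close> and, for each \<open>h \<in> {1..H}\<close>, \<open>D h\<close> (of size \<open>q h \<times> n\<close>), \<open>d h\<close>, \<open>Q h\<close>.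
  The reduced problem has the same form, with data \<open>A\<^sub>1\<close>, \<open>b\<close>, \<open>K\<^sub>1\<close>, \<open>D\<^sub>1 h\<close>, \<open>d h\<close>, \<open>Q h\<close>.\<close>

definition cgcp_feasible ::
  "nat \<Rightarrow> nat \<Rightarrow> nat \<Rightarrow> (nat \<Rightarrow> nat) \<Rightarrow> real mat \<Rightarrow> real vec \<Rightarrow> real vec set \<Rightarrow>
   (nat \<Rightarrow> real mat) \<Rightarrow> (nat \<Rightarrow> real vec) \<Rightarrow> (nat \<Rightarrow> real vec set) \<Rightarrow>
   real vec \<Rightarrow> real \<Rightarrow> (nat \<Rightarrow> real vec) \<Rightarrow> (nat \<Rightarrow> real vec) \<Rightarrow> (nat \<Rightarrow> real vec) \<Rightarrow> bool"
  where
  "cgcp_feasible H m n q A b K D d Q \<alpha> \<beta> u lam v \<longleftrightarrow>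
     \<alpha> \<in> carrier_vec n \<and>
     (\<forall>h\<in>{1..H}. \<alpha> = A\<^sup>T *\<^sub>v u h + lam h + (D h)\<^sup>T *\<^sub>v v h) \<and>
     (\<forall>h\<in>{1..H}. \<beta> \<le> b \<bullet> u h + d h \<bullet> v h) \<and>
     (\<forall>h\<in>{1..H}. u h \<in> carrier_vec m \<and> lam h \<in> dual_cone n K \<and> v h \<in> dual_cone (q h) (Q h))"

definition cgcp_objective :: "real vec \<Rightarrow> real vec \<Rightarrow> real \<Rightarrow> real" where
  "cgcp_objective x \<alpha> \<beta> = \<alpha> \<bullet> x - \<beta>"

end

theory Submission
  imports Defs
begin

text \<open>Everything splits along the two blocks of coordinates. By
  \<open>transpose_append_cols_mult_vec\<close>, \<open>A\<close> and \<open>D h\<close> transposed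
  act blockwise, so for each \<open>h\<close> the equality constraint falls into two: the first
  block is the reduced constraint, and the second holds because \<open>lam2 h\<close> is the slack
  it leaves. This slack lies in the dual of \<open>K2\<close> by the hypothesis on
  \<open>\<alpha>2\<close>, and \<open>append_in_dual_cone_prod\<close> glues it to
  \<open>lam1 h\<close>. The remaining constraints are common to both problems, and the objective is
  unchanged because \<open>\<alpha>2\<close> is paired with zero.\<close>

text \<open>Each entry pairs a column of the block matrix with \<open>u\<close>, and that column
  comes from \<open>A\<close> or from \<open>B\<close> according to its index. The same columns meet
  the same \<open>u\<close> on both sides, so the dimension of \<open>u\<close> may be
  arbitrary.\<close>

lemma transpose_append_cols_mult_vec:
  assumes "A \<in> carrier_mat m n1" and "B \<in> carrier_mat m n2"
  shows "(A @\<^sub>c B)\<^sup>T *\<^sub>v u = (A\<^sup>T *\<^sub>v u) @\<^sub>v (B\<^sup>T *\<^sub>v (u :: 'a::semiring_0 vec))"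
proof (rule eq_vecI)
  show "dim_vec ((A @\<^sub>c B)\<^sup>T *\<^sub>v u) = dim_vec ((A\<^sup>T *\<^sub>v u) @\<^sub>v (B\<^sup>T *\<^sub>v u))"
    using assms by (auto simp: append_cols_def)
next
  fix i
  assume "i < dim_vec ((A\<^sup>T *\<^sub>v u) @\<^sub>v (B\<^sup>T *\<^sub>v u))"
  then have i: "i < n1 + n2" using assms by simp
  have "col (A @\<^sub>c B) i = (if i < n1 then col A i else col B (i - n1))"
    using assms i by (intro eq_vecI) (auto simp: append_cols_def)
  then show "((A @\<^sub>c B)\<^sup>T *\<^sub>v u) $ i = ((A\<^sup>T *\<^sub>v u) @\<^sub>v (B\<^sup>T *\<^sub>v u)) $ i"
    using assms i carrier_matD(2)[OF append_cols_carrier[OF assms]] by auto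
qed

text \<open>The inner product of two concatenations is the sum of the blockwise inner products, here
  two nonnegative terms. The carrier assumptions make the blocks match.\<close>

lemma append_in_dual_cone_prod:
  assumes "C \<subseteq> carrier_vec n1" and "D \<subseteq> carrier_vec n2"
    and "x \<in> dual_cone n1 C" and "y \<in> dual_cone n2 D"
  shows "x @\<^sub>v y \<in> dual_cone (n1 + n2) (cone_prod C D)"
proof -
  have "(x @\<^sub>v y) \<bullet> (c @\<^sub>v d) \<ge> 0" if "c \<in> C" "d \<in> D" for c d
  proof -
    have "(x @\<^sub>v y) \<bullet> (c @\<^sub>v d) = x \<bullet> c + y \<bullet> d"
      using assms that by (intro scalar_prod_append[of _ n1 _ n2]) (auto simp: dual_cone_def)
    then show ?thesis using assms that by (simp add: dual_cone_def)
  qed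
  then show ?thesis using assms by (auto simp: dual_cone_def cone_prod_def)
qed

theorem lemma4:
  fixes H m n n1 n2 :: nat and q :: "nat \<Rightarrow> nat"
    and A A1 A2 :: "real mat" and b :: "real vec" and K K1 K2 :: "real vec set"
    and D D1 D2 :: "nat \<Rightarrow> real mat" and d :: "nat \<Rightarrow> real vec" and Q :: "nat \<Rightarrow> real vec set"
    and xbar xbar1 xbar2 :: "real vec"
    and \<alpha> \<alpha>1 \<alpha>2 :: "real vec" and \<beta> :: real
    and u lam lam1 lam2 v :: "nat \<Rightarrow> real vec"
  assumes "n = n1 + n2"
    and "A1 \<in> carrier_mat m n1" and "A2 \<in> carrier_mat m n2" and "A = A1 @\<^sub>c A2"
    and "b \<in> carrier_vec m"
    and "proper_cone n1 K1" and "proper_cone n2 K2" and "K = cone_prod K1 K2"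
    and "\<And>h. h \<in> {1..H} \<Longrightarrow> D1 h \<in> carrier_mat (q h) n1"
    and "\<And>h. h \<in> {1..H} \<Longrightarrow> D2 h \<in> carrier_mat (q h) n2"
    and "\<And>h. h \<in> {1..H} \<Longrightarrow> D h = D1 h @\<^sub>c D2 h"
    and "\<And>h. h \<in> {1..H} \<Longrightarrow> d h \<in> carrier_vec (q h)"
    and "\<And>h. h \<in> {1..H} \<Longrightarrow> proper_cone (q h) (Q h)"
    and "xbar1 \<in> carrier_vec n1" and "xbar2 \<in> carrier_vec n2" and "xbar = xbar1 @\<^sub>v xbar2"
    and "A *\<^sub>v xbar = b"
    and "xbar2 = 0\<^sub>v n2"
    and "cgcp_feasible H m n1 q A1 b K1 D1 d Q \<alpha>1 \<beta> u lam1 v"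
    and "\<alpha>2 \<in> carrier_vec n2"
    and "\<And>h. h \<in> {1..H} \<Longrightarrow> \<alpha>2 - (A2\<^sup>T *\<^sub>v u h + (D2 h)\<^sup>T *\<^sub>v v h) \<in> dual_cone n2 K2"
    and "\<And>h. h \<in> {1..H} \<Longrightarrow> lam2 h = \<alpha>2 - A2\<^sup>T *\<^sub>v u h - (D2 h)\<^sup>T *\<^sub>v v h"
    and "\<alpha> = \<alpha>1 @\<^sub>v \<alpha>2"
    and "\<And>h. h \<in> {1..H} \<Longrightarrow> lam h = lam1 h @\<^sub>v lam2 h"
  shows "cgcp_feasible H m n q A b K D d Q \<alpha> \<beta> u lam v
    \<and> cgcp_objective xbar \<alpha> \<beta> = cgcp_objective xbar1 \<alpha>1 \<beta>"
proof
  have cones: "K1 \<subseteq> carrier_vec n1" "K2 \<subseteq> carrier_vec n2"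
    using assms(6,7) by (auto simp: proper_cone_def)
  have \<alpha>1: "\<alpha>1 \<in> carrier_vec n1" using assms(19) by (simp add: cgcp_feasible_def)
  have row: "\<alpha> = A\<^sup>T *\<^sub>v u h + lam h + (D h)\<^sup>T *\<^sub>v v h"
    and cone: "lam h \<in> dual_cone n K" if h: "h \<in> {1..H}" for h
  proof -
    note Ah = assms(2,3) and Dh = assms(9,10)[OF h]
    \<comment> \<open>With the four products opaque, the vector identities below are checked
      entrywise from the dimensions alone.\<close>
    define p1 p2 r1 r2 where "p1 = A1\<^sup>T *\<^sub>v u h" and "p2 = A2\<^sup>T *\<^sub>v u h"
      and "r1 = (D1 h)\<^sup>T *\<^sub>v v h" and "r2 = (D2 h)\<^sup>T *\<^sub>v v h"
    note defs = p1_def p2_def r1_def r2_def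
    have carr: "p1 \<in> carrier_vec n1" "p2 \<in> carrier_vec n2" "r1 \<in> carrier_vec n1" "r2 \<in> carrier_vec n2"
      using Ah Dh by (auto simp: defs intro!: carrier_vecI)
    have A: "A\<^sup>T *\<^sub>v u h = p1 @\<^sub>v p2" and D: "(D h)\<^sup>T *\<^sub>v v h = r1 @\<^sub>v r2"
      using transpose_append_cols_mult_vec[OF Ah] transpose_append_cols_mult_vec[OF Dh] assms(4) assms(11)[OF h]
      by (simp_all add: defs)
    have \<alpha>1_eq: "\<alpha>1 = p1 + lam1 h + r1" and lam1: "lam1 h \<in> dual_cone n1 K1"
      using assms(19) h unfolding cgcp_feasible_def defs by blast+
    have lam2_eq: "lam2 h = \<alpha>2 - p2 - r2" using assms(22)[OF h] by (simp add: defs)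
    \<comment> \<open>The slack subtracts the two products in turn, the hypothesis on
      \<open>\<alpha>2\<close> subtracts their sum.\<close>
    also have "\<dots> = \<alpha>2 - (p2 + r2)" using carr assms(20) by (intro eq_vecI) auto
    finally have lam2: "lam2 h \<in> dual_cone n2 K2" using assms(21)[OF h] by (simp add: defs)
    have lam_carr: "lam1 h \<in> carrier_vec n1" "lam2 h \<in> carrier_vec n2"
      using lam1 lam2 by (auto simp: dual_cone_def)
    \<comment> \<open>Solving the definition of the slack for \<open>\<alpha>2\<close> gives the
      second block of the constraint.\<close>
    have "\<alpha>2 = p2 + lam2 h + r2" unfolding lam2_eq using carr assms(20) by (intro eq_vecI) auto
    then have "\<alpha> = (p1 + lam1 h + r1) @\<^sub>v (p2 + lam2 h + r2)" using assms(23) \<alpha>1_eq by simp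
    also have "\<dots> = (p1 @\<^sub>v p2) + (lam1 h @\<^sub>v lam2 h) + (r1 @\<^sub>v r2)"
      using carr lam_carr by (intro eq_vecI) auto
    finally show "\<alpha> = A\<^sup>T *\<^sub>v u h + lam h + (D h)\<^sup>T *\<^sub>v v h"
      by (simp add: A D assms(24)[OF h])
    show "lam h \<in> dual_cone n K"
      using append_in_dual_cone_prod[OF cones lam1 lam2] by (simp add: assms(1,8) assms(24)[OF h])
  qed
  show "cgcp_feasible H m n q A b K D d Q \<alpha> \<beta> u lam v"
    unfolding cgcp_feasible_def
  proof (intro conjI ballI)
    show "\<alpha> \<in> carrier_vec n" using assms(1,20,23) \<alpha>1 by simp
  next
    fix h assume h: "h \<in> {1..H}"
    show "\<alpha> = A\<^sup>T *\<^sub>v u h + lam h + (D h)\<^sup>T *\<^sub>v v h" by (rule row[OF h])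
    \<comment> \<open>These conditions involve neither \<open>A\<close>, \<open>D\<close> nor
      \<open>K\<close>, so they carry over from the reduced problem verbatim.\<close>
    show "\<beta> \<le> b \<bullet> u h + d h \<bullet> v h" and "u h \<in> carrier_vec m"
      and "v h \<in> dual_cone (q h) (Q h)"
      using assms(19) h unfolding cgcp_feasible_def by blast+
    show "lam h \<in> dual_cone n K" by (rule cone[OF h])
  qed
  \<comment> \<open>The second summand vanishes since \<open>xbar2\<close> is zero.\<close>
  have "\<alpha> \<bullet> xbar = \<alpha>1 \<bullet> xbar1 + \<alpha>2 \<bullet> xbar2"
    unfolding assms(16,23) using \<alpha>1 assms(14,15,20) by (intro scalar_prod_append)
  then show "cgcp_objective xbar \<alpha> \<beta> = cgcp_objective xbar1 \<alpha>1 \<beta>"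
    using assms(18,20) by (simp add: cgcp_objective_def)
qed

end
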